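(* Let $k>0$. Let the sequence $(V_j)_{j\ge 0}$ be defined by $V_0=1$, $V_1=1+k$ and $$V_{j+1}-2V_j+V_{j-1}=\frac{k}{V_j},\qquad j=1,2,\ldots,$$ and let $W_j=j\,(2k\ln j)^{1/2}$ for $j=1,2,\ldots$. Then $$\lim_{j\to\infty}\frac{V_j}{W_j}=1 .$$ *)

theory Defs
  imports Complex_Main
begin

end

theory Submission imports Defs "HOL-Real_Asymp.Real_Asymp" begin

text \<open>Put \<open>d\<^sub>j = V\<^sub>j\<^sub>+\<^sub>1 - V\<^sub>j\<close>, an increasing sequence, and use the Stolz--Cesaro theorem
  repeatedly. The increments of \<open>j d\<^sub>j - V\<^sub>j\<close> are \<open>(j+1) k / V\<^sub>j\<^sub>+\<^sub>1\<close>. If \<open>d\<^sub>j\<close> had a finite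
  limit \<open>D\<close>, then \<open>V\<^sub>j / j\<close> would tend to \<open>D\<close>, and \<open>d\<^sub>j - V\<^sub>j / j\<close> both to \<open>0\<close> and to \<open>k / D\<close>;
  hence \<open>d\<^sub>j\<close> and \<open>V\<^sub>j / j\<close> tend to infinity. Now the same increments tend to \<open>0\<close>, which gives
  \<open>V\<^sub>j \<sim> j d\<^sub>j\<close>. Finally, the increments \<open>k (d\<^sub>j\<^sub>+\<^sub>1 + d\<^sub>j) / V\<^sub>j\<^sub>+\<^sub>1\<close> of \<open>d\<^sub>j\<^sup>2\<close> are asymptotic
  to \<open>2 k / j\<close>, so \<open>d\<^sub>j\<^sup>2 \<sim> 2 k ln j\<close>.\<close>

text \<open>From some \<open>N\<close> on, each increment of \<open>a - L * b\<close> is at most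
  \<open>e / 2\<close> times that of \<open>b\<close>. Summing gives
  \<open>\<bar>a n - L * b n\<bar> \<le> C + e / 2 * b n\<close>, and the constant \<open>C\<close>
  is absorbed because \<open>b\<close> tends to infinity.\<close>

lemma stolz_cesaro:
  fixes a b :: "nat \<Rightarrow> real"
  assumes b: "filterlim b at_top sequentially"
    and mono: "eventually (\<lambda>n. b n < b (Suc n)) sequentially"
    and lim: "(\<lambda>n. (a (Suc n) - a n) / (b (Suc n) - b n)) \<longlonglongrightarrow> L"
  shows "(\<lambda>n. a n / b n) \<longlonglongrightarrow> L"
proof (rule LIMSEQ_I)
  fix e :: real assume e: "e > 0"
  have "eventually (\<lambda>n. \<bar>(a (Suc n) - a n) / (b (Suc n) - b n) - L\<bar> < e / 2) sequentially"
    using tendstoD[OF lim, of "e / 2"] e by (simp add: dist_real_def)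
  with mono obtain N where N: "\<And>n. n \<ge> N \<Longrightarrow> b n < b (Suc n)"
    "\<And>n. n \<ge> N \<Longrightarrow> \<bar>(a (Suc n) - a n) / (b (Suc n) - b n) - L\<bar> < e / 2"
    using eventually_conj[OF mono, of "\<lambda>n. \<bar>(a (Suc n) - a n) / (b (Suc n) - b n) - L\<bar> < e / 2"]
    unfolding eventually_sequentially by blast
  have increment: "\<bar>(a (Suc n) - L * b (Suc n)) - (a n - L * b n)\<bar> \<le> e / 2 * (b (Suc n) - b n)"
    if "n \<ge> N" for n
  proof -
    have pos: "b (Suc n) - b n > 0" using N(1)[OF that] by simp
    have "(a (Suc n) - L * b (Suc n)) - (a n - L * b n)
        = ((a (Suc n) - a n) / (b (Suc n) - b n) - L) * (b (Suc n) - b n)"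
      using pos by (simp add: field_simps)
    then show ?thesis
      using N(2)[OF that] pos by (simp add: abs_mult)
  qed
  \<comment> \<open>This value turns the bound below into an equality at \<open>n = N\<close>, the
    start of the induction.\<close>
  define C where "C = \<bar>a N - L * b N\<bar> - e / 2 * b N"
  have bound: "\<bar>a n - L * b n\<bar> \<le> C + e / 2 * b n" if "n \<ge> N" for n
    using that
  proof (induction n rule: dec_induct)
    case base
    then show ?case by (simp add: C_def)
  next
    case (step n)
    then show ?case using increment[of n] unfolding right_diff_distrib by linarith
  qed
  have "eventually (\<lambda>n. b n > max 0 (2 * C / e)) sequentially"
    using b unfolding filterlim_at_top_dense by blast
  then obtain M where M: "\<And>n. n \<ge> M \<Longrightarrow> b n > max 0 (2 * C / e)"
    unfolding eventually_sequentially by blast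
  have "norm (a n / b n - L) < e" if "n \<ge> max M N" for n
  proof -
    have pos: "b n > 0" and "2 * C / e < b n" using M[of n] that by auto
    then have "C < e / 2 * b n" using e by (simp add: field_simps)
    then have "\<bar>a n - L * b n\<bar> < e * b n" using bound[of n] that by simp
    moreover have "a n / b n - L = (a n - L * b n) / b n" using pos by (simp add: field_simps)
    ultimately show ?thesis using pos by (simp add: field_simps)
  qed
  then show "\<exists>no. \<forall>n\<ge>no. norm (a n / b n - L) < e" by blast
qed

theorem theorem4p1:
  fixes k :: real and V W :: "nat \<Rightarrow> real"
  assumes "k > 0"
    and "V 0 = 1" and "V 1 = 1 + k"
    and "\<And>j. j \<ge> 1 \<Longrightarrow> V (j + 1) - 2 * V j + V (j - 1) = k / V j"
    and "\<And>j. j \<ge> 1 \<Longrightarrow> W j = real j * sqrt (2 * k * ln (real j))"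
  shows "(\<lambda>j. V j / W j) \<longlonglongrightarrow> 1"
proof -
  define d where "d j = V (Suc j) - V j" for j
  have d0: "d 0 = k" using assms(2,3) by (simp add: d_def)
  have d_Suc: "d (Suc j) = d j + k / V (Suc j)" for j
    using assms(4)[of "Suc j"] by (simp add: d_def)
  have V_Suc: "V (Suc j) = V j + d j" for j by (simp add: d_def)
  \<comment> \<open>The two claims need a joint induction: \<open>d j > 0\<close> keeps
    \<open>V\<close> positive, and \<open>V (Suc j) > 0\<close> makes \<open>d\<close>
    increase.\<close>
  have pos: "V j > 0 \<and> d j \<ge> k" for j
  proof (induction j)
    case 0
    then show ?case using assms(2) d0 by simp
  next
    case (Suc j)
    then have "V (Suc j) > 0" using assms(1) V_Suc[of j] by simp
    moreover from this have "k / V (Suc j) > 0" using assms(1) by simp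
    ultimately show ?case using Suc d_Suc[of j] by linarith
  qed
  have V_pos: "V j > 0" and d_ge: "d j \<ge> k" and d_pos: "d j > 0" for j
    using pos[of j] assms(1) by auto
  have V_ge: "V j \<ge> k * real j" for j
  proof (induction j)
    case (Suc j)
    then show ?case using V_Suc[of j] d_ge[of j] by (simp add: algebra_simps)
  qed (use assms(2) in simp)
  have "filterlim (\<lambda>j. k * real j) at_top sequentially" using assms(1) by real_asymp
  then have V_top: "filterlim V at_top sequentially"
    by (rule filterlim_at_top_mono) (simp add: V_ge)
  have nat_top: "filterlim real at_top sequentially" by real_asymp
  define g where "g j = real j * d j - V j" for j
  have g_Suc: "g (Suc j) - g j = k * (real (Suc j) / V (Suc j))" for j
    using d_Suc[of j] V_Suc[of j] by (simp add: g_def algebra_simps)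
  have g_lim: "(\<lambda>j. g j / real j) \<longlonglongrightarrow> L" if "(\<lambda>j. k * (real j / V j)) \<longlonglongrightarrow> L" for L
    by (rule stolz_cesaro[OF nat_top]) (use LIMSEQ_Suc[OF that] in \<open>simp_all add: g_Suc\<close>)
  have g_eq: "g j / real j = d j - V j / real j" if "j > 0" for j
    using that by (simp add: g_def field_simps)
  have "incseq d"
    using d_Suc V_pos assms(1) by (intro incseq_SucI) (simp add: less_imp_le)
  have d_top: "filterlim d at_top sequentially"
  proof (rule ccontr)
    assume "\<not> ?thesis"
    then obtain B where B: "\<not> eventually (\<lambda>j. B \<le> d j) sequentially"
      unfolding filterlim_at_top by blast
    \<comment> \<open>By monotonicity, a single value of \<open>d\<close> above \<open>B\<close>
      would keep all later ones above \<open>B\<close>.\<close>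
    have "d j \<le> B" for j
    proof (rule ccontr)
      assume "\<not> d j \<le> B"
      then have "B \<le> d i" if "i \<ge> j" for i
        using incseqD[OF \<open>incseq d\<close> that] by linarith
      with B show False unfolding eventually_sequentially by blast
    qed
    then obtain D where D: "d \<longlonglongrightarrow> D"
      using incseq_convergent[OF \<open>incseq d\<close>] by blast
    have "D \<ge> k" by (rule LIMSEQ_le_const[OF D]) (use d_ge in blast)
    then have "D > 0" using assms(1) by simp
    have VD: "(\<lambda>j. V j / real j) \<longlonglongrightarrow> D"
      by (rule stolz_cesaro[OF nat_top]) (use D in \<open>simp_all add: d_def[abs_def]\<close>)
    have "(\<lambda>j. k * inverse (V j / real j)) \<longlonglongrightarrow> k * inverse D"
      using \<open>D > 0\<close> by (intro tendsto_intros VD) simp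
    then have "(\<lambda>j. g j / real j) \<longlonglongrightarrow> k * inverse D"
      by (intro g_lim) simp
    moreover have "(\<lambda>j. g j / real j) \<longlonglongrightarrow> D - D"
      by (rule Lim_transform_eventually[OF tendsto_diff[OF D VD]])
        (rule eventually_mono[OF eventually_gt_at_top[of 0]], simp add: g_eq)
    ultimately have "k * inverse D = D - D" by (rule LIMSEQ_unique)
    then show False using assms(1) \<open>D > 0\<close> by simp
  qed
  \<comment> \<open>The quotients of increments are \<open>1 / d n\<close>.\<close>
  have jV: "(\<lambda>j. real j / V j) \<longlonglongrightarrow> 0"
  proof (rule stolz_cesaro[OF V_top])
    show "(\<lambda>n. (real (Suc n) - real n) / (V (Suc n) - V n)) \<longlonglongrightarrow> 0"
      using tendsto_inverse_0_at_top[OF d_top] by (simp add: d_def inverse_eq_divide)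
  qed (use V_Suc d_pos in simp)
  have "(\<lambda>j. k * (real j / V j)) \<longlonglongrightarrow> 0"
    using tendsto_mult_right_zero[OF jV] by blast
  \<comment> \<open>By definition of \<open>g\<close>,
    \<open>j * d j / V j = 1 + (g j / j) * (j / V j)\<close>, and both factors of the product tend
    to 0.\<close>
  from tendsto_mult[OF g_lim[OF this] jV]
  have "(\<lambda>j. 1 + g j / real j * (real j / V j)) \<longlonglongrightarrow> 1 + 0"
    by (intro tendsto_add tendsto_const) simp
  moreover have "eventually (\<lambda>j. 1 + g j / real j * (real j / V j) = real j * d j / V j) sequentially"
    using eventually_gt_at_top[of 0]
  proof eventually_elim
    case (elim j)
    then have "g j / real j * (real j / V j) = g j / V j" by simp
    then show ?case using V_pos[of j] by (simp add: g_def diff_divide_distrib)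
  qed
  ultimately have dV: "(\<lambda>j. real j * d j / V j) \<longlonglongrightarrow> 1"
    using Lim_transform_eventually by fastforce
  \<comment> \<open>Difference of squares, with \<open>d j\<close> replaced by
    \<open>d (Suc j) - k / V (Suc j)\<close> so that all indices agree.\<close>
  have inc: "(d (Suc j))\<^sup>2 - (d j)\<^sup>2 = k * (2 * d (Suc j) - k / V (Suc j)) / V (Suc j)" for j
    by (simp add: d_Suc power2_eq_square add_divide_distrib algebra_simps)
  \<comment> \<open>Numerator and denominator of the Stolz-Cesaro quotient are both multiplied by
    \<open>Suc j\<close>, so that every factor has a known limit.\<close>
  have lim: "(\<lambda>j. k * (2 * (real (Suc j) * d (Suc j) / V (Suc j))
          - k * (real (Suc j) / V (Suc j)) * inverse (V (Suc j)))
        / (2 * k * (real (Suc j) * (ln (real (Suc j)) - ln (real j)))))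
      \<longlonglongrightarrow> k * (2 * 1 - k * 0 * 0) / (2 * k * 1)"
  proof (intro tendsto_divide tendsto_mult tendsto_diff tendsto_const)
    show "(\<lambda>j. real (Suc j) * d (Suc j) / V (Suc j)) \<longlonglongrightarrow> 1" by (rule LIMSEQ_Suc[OF dV])
    show "(\<lambda>j. real (Suc j) / V (Suc j)) \<longlonglongrightarrow> 0" by (rule LIMSEQ_Suc[OF jV])
    show "(\<lambda>j. inverse (V (Suc j))) \<longlonglongrightarrow> 0"
      by (rule LIMSEQ_Suc[OF tendsto_inverse_0_at_top[OF V_top]])
    show "(\<lambda>j. real (Suc j) * (ln (real (Suc j)) - ln (real j))) \<longlonglongrightarrow> 1" by real_asymp
  qed (use assms(1) in simp)
  \<comment> \<open>Cancels the common factor \<open>x\<close>. If \<open>v = 0\<close> or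
    \<open>l = m\<close>, both sides are 0 by the convention for division, so the rewriting also
    covers \<open>j = 0\<close>.\<close>
  have quotient: "k * (2 * (x * e / v) - k * (x / v) * inverse v) / (2 * k * (x * (l - m)))
      = k * (2 * e - k / v) / v / (2 * k * l - 2 * k * m)"
    if "x > 0" for x e v l m :: real
  proof -
    have "k * (2 * (x * e / v) - k * (x / v) * inverse v) = x * (k * (2 * e - k / v) / v)"
      by (simp add: divide_inverse algebra_simps)
    moreover have "2 * k * (x * (l - m)) = x * (2 * k * l - 2 * k * m)"
      by (simp add: algebra_simps)
    ultimately show ?thesis using that by simp
  qed
  have "(\<lambda>j. ((d (Suc j))\<^sup>2 - (d j)\<^sup>2) / (2 * k * ln (real (Suc j)) - 2 * k * ln (real j)))
      \<longlonglongrightarrow> 1"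
    using lim assms(1) by (subst (asm) quotient) (simp_all add: inc)
  then have "(\<lambda>j. (d j)\<^sup>2 / (2 * k * ln (real j))) \<longlonglongrightarrow> 1"
  proof (rule stolz_cesaro[rotated 2])
    show "filterlim (\<lambda>j. 2 * k * ln (real j)) at_top sequentially"
      using assms(1) by real_asymp
    show "eventually (\<lambda>j. 2 * k * ln (real j) < 2 * k * ln (real (Suc j))) sequentially"
      using eventually_gt_at_top[of 0] by eventually_elim (use assms(1) in simp)
  qed
  from tendsto_divide[OF tendsto_real_sqrt[OF this] dV]
  have "(\<lambda>j. sqrt ((d j)\<^sup>2 / (2 * k * ln (real j))) / (real j * d j / V j)) \<longlonglongrightarrow> 1" by simp
  then show ?thesis
  proof (rule Lim_transform_eventually)
    \<comment> \<open>Since \<open>d j > 0\<close>, the root of the square is \<open>d j\<close>,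
      which then cancels.\<close>
    show "eventually (\<lambda>j. sqrt ((d j)\<^sup>2 / (2 * k * ln (real j))) / (real j * d j / V j)
        = V j / W j) sequentially"
      using eventually_gt_at_top[of 0]
    proof eventually_elim
      case (elim j)
      then show ?case
        using assms(5)[of j] d_pos[of j] by (simp add: real_sqrt_divide)
    qed
  qed
qed

end
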